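(* Let $X$ be a separable real Banach space and let $G$ be a group of isomorphisms on $X$ which is the group of isometries on $X$ in some equivalent norm. If $G$ is countable, then $G$ is discrete for the convergence of $T$ and $T^{-1}$ in the strong operator topology, and $G$ admits a separating point. If $X$ is finite dimensional and $G$ is countable, then $G$ is finite.
   Context: An isomorphism on $X$ is a bounded linear bijection of $X$ onto itself. The group of isometries for a given norm is the group of all surjective linear isometries of $X$ onto itself for that norm. Countable means finite or countably infinite. The topology of convergence of $T$ and $T^{-1}$ in the strong operator topology on $G$ is the topology induced by the map $T\mapsto(T,T^{-1})$ into $L(X)\times L(X)$, where $L(X)$ carries the strong operator topology. A separating point for $G$ is a point $x_0\in X$ such that $gx_0\neq hx_0$ whenever $g\neq h$ in $G$. *)

theory Defs
  imports "HOL-Analysis.Analysis" "HOL-Algebra.Group"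
begin

text \<open>On a Banach space the inverse of a bounded linear bijection is bounded by the open mapping
  theorem, so \<open>inv\<^bsub>isomorphisms\<^esub> T\<close> is the inverse operator; see the lemma below.\<close>

definition isomorphisms :: "('a::banach \<Rightarrow>\<^sub>L 'a) monoid"
  where "isomorphisms =
    \<lparr>carrier = {T. bij (blinfun_apply T)}, mult = (o\<^sub>L), one = id_blinfun\<rparr>"

lemma m_inv_isomorphisms:
  fixes T :: "'a::banach \<Rightarrow>\<^sub>L 'a"
  assumes "bij (blinfun_apply T)" and "bounded_linear (inv_into UNIV (blinfun_apply T))"
  shows "blinfun_apply (inv\<^bsub>isomorphisms\<^esub> T) = inv_into UNIV (blinfun_apply T)"
proof -
  define S where "S = Blinfun (inv_into UNIV (blinfun_apply T))"
  have S: "blinfun_apply S = inv_into UNIV (blinfun_apply T)"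
    using assms(2) by (simp add: S_def bounded_linear_Blinfun_apply)
  have TS_apply: "blinfun_apply T (blinfun_apply S x) = x" for x
    unfolding S using assms(1) by (simp add: bij_is_surj surj_f_inv_f)
  have ST_apply: "blinfun_apply S (blinfun_apply T x) = x" for x
    unfolding S using assms(1) by (simp add: bij_is_inj inv_f_f)
  have TS: "T o\<^sub>L S = id_blinfun"
    by (rule blinfun_eqI) (simp only: blinfun_apply_blinfun_compose blinfun_apply_id_blinfun TS_apply)
  have ST: "S o\<^sub>L T = id_blinfun"
    by (rule blinfun_eqI) (simp only: blinfun_apply_blinfun_compose blinfun_apply_id_blinfun ST_apply)
  have bij_S: "bij (blinfun_apply S)"
    using assms(1) by (simp add: S bij_imp_bij_inv)
  have unique: "R = S" if "R o\<^sub>L T = id_blinfun" for R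
  proof (rule blinfun_eqI)
    fix x
    have "blinfun_apply R x = blinfun_apply (R o\<^sub>L T) (blinfun_apply S x)"
      by (simp only: blinfun_apply_blinfun_compose TS_apply)
    then show "blinfun_apply R x = blinfun_apply S x"
      by (simp only: that blinfun_apply_id_blinfun)
  qed
  have "inv\<^bsub>isomorphisms\<^esub> T = S"
    unfolding m_inv_def isomorphisms_def
  proof (rule the_equality, goal_cases)
    case 1
    show ?case by (simp add: bij_S TS ST)
  next
    case (2 R)
    then show ?case by (intro unique) simp
  qed
  then show ?thesis by (simp add: S)
qed

definition is_norm :: "('a::real_vector \<Rightarrow> real) \<Rightarrow> bool"
  where "is_norm N \<longleftrightarrow>
    (\<forall>x. 0 \<le> N x) \<and> (\<forall>x. N x = 0 \<longleftrightarrow> x = 0) \<and>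
    (\<forall>c x. N (c *\<^sub>R x) = \<bar>c\<bar> * N x) \<and> (\<forall>x y. N (x + y) \<le> N x + N y)"

definition equivalent_norm :: "('a::real_normed_vector \<Rightarrow> real) \<Rightarrow> bool"
  where "equivalent_norm N \<longleftrightarrow>
    is_norm N \<and> (\<exists>c>0. \<exists>C>0. \<forall>x. c * norm x \<le> N x \<and> N x \<le> C * norm x)"

definition isometries :: "('a::real_vector \<Rightarrow> real) \<Rightarrow> ('a \<Rightarrow> 'a) set"
  where "isometries N = {f. linear f \<and> surj f \<and> (\<forall>x. N (f x) = N x)}"

definition SOT_inverse_topology :: "('a::banach \<Rightarrow>\<^sub>L 'a) set \<Rightarrow> ('a \<Rightarrow>\<^sub>L 'a) topology"
  where "SOT_inverse_topology G =
    pullback_topology G (\<lambda>T. (T, inv\<^bsub>isomorphisms\<^esub> T))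
      (prod_topology strong_operator_topology strong_operator_topology)"

definition separating_point :: "('a::banach \<Rightarrow>\<^sub>L 'a) set \<Rightarrow> 'a \<Rightarrow> bool"
  where "separating_point G x \<longleftrightarrow>
    (\<forall>g\<in>G. \<forall>h\<in>G. g \<noteq> h \<longrightarrow> blinfun_apply g x \<noteq> blinfun_apply h x)"

definition finite_dimensional :: "'a::real_vector itself \<Rightarrow> bool"
  where "finite_dimensional _ \<longleftrightarrow> (\<exists>B::'a set. finite B \<and> span B = UNIV)"

end

theory Submission
  imports Defs
begin

text \<open>
  Fix a dense sequence \<open>d\<close> in \<open>X\<close> and record an operator \<open>T \<in> G\<close> by the sequence of pairs
  \<open>(T (d n), T\<inverse> (d n))\<close>. By density this trace determines \<open>T\<close>, and since the
  members of \<open>G\<close> are uniformly bounded, convergence of traces is pointwise convergence of \<open>T\<close>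
  and \<open>T\<inverse>\<close> on all of \<open>X\<close>. So \<open>G\<close> sits inside the complete metric space of sequences in \<open>X \<times> X\<close>.

  The image of \<open>G\<close> is closed there (\<open>closed_dense_trace\<close>): a pointwise limit of isometries whose
  inverses also converge pointwise is a surjective isometry, and \<open>G\<close> contains every surjective
  isometry of its norm. This is where it matters that \<open>G\<close> is the full isometry group and that the
  inverses are recorded as well. A countable nonempty closed subset of a complete metric space has an
  isolated point by Baire's theorem, and left translations carry one isolated point of a group to
  any other (\<open>member_isolated_by_trace\<close>). Hence \<open>G\<close> is discrete.

  If \<open>X\<close> is finite-dimensional, its balls are compact, so by Tychonoff the traces of \<open>G\<close> lie in a
  compact set; infinitely many of them would accumulate at the trace of a member of \<open>G\<close>, which
  would not be isolated.

  A separating point comes from a second use of Baire's theorem: the kernels of the differences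
  \<open>g - h\<close> of distinct members of \<open>G\<close> are countably many closed nowhere dense sets
  (\<open>countable_set_has_separating_point\<close>).
\<close>

section \<open>Consequences of the Baire category theorem\<close>

text \<open>Otherwise the set, as a complete metric space, would be the countable union of its singletons,
  all of them nowhere dense in it.\<close>

lemma countable_closed_has_isolated_point:
  fixes P :: "'a::complete_space set"
  assumes "closed P" "countable P" "P \<noteq> {}"
  obtains p U where "p \<in> P" "open U" "U \<inter> P = {p}"
proof -
  have cm: "completely_metrizable_space (top_of_set P)"
    using assms(1) by (simp add: completely_metrizable_space_closedin completely_metrizable_space_euclidean)
  have "\<exists>p\<in>P. top_of_set P interior_of {p} \<noteq> {}"
  proof (rule ccontr)
    assume "\<not> ?thesis"
    then have "top_of_set P interior_of \<Union>((\<lambda>p. {p}) ` P) = {}"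
      using cm assms(2) by (intro Baire_category_alt)
        (auto intro!: closedin_singleton Hausdorff_imp_t1_space simp: closedin_closed_eq closed_subset)
    moreover have "top_of_set P interior_of P = P"
      by (metis interior_of_topspace topspace_euclidean_subtopology)
    ultimately show False
      using assms(3) by simp
  qed
  then obtain p where p: "p \<in> P" "top_of_set P interior_of {p} \<noteq> {}"
    by blast
  then have "top_of_set P interior_of {p} = {p}"
    using interior_of_subset[of "top_of_set P" "{p}"] by blast
  then have "openin (top_of_set P) {p}"
    by (metis openin_interior_of)
  then obtain U where "open U" "{p} = P \<inter> U"
    unfolding openin_open by blast
  with p(1) that show ?thesis by blast
qed

text \<open>A ball around a point of the subspace, translated to the origin, absorbs every vector.\<close>

lemma subspace_with_interior_eq_UNIV:
  fixes S :: "'a::real_normed_vector set"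
  assumes "subspace S" "interior S \<noteq> {}"
  shows "S = UNIV"
proof -
  obtain a e where e: "e > 0" "ball a e \<subseteq> S"
    using assms(2) by (metis all_not_in_conv mem_interior)
  have "x \<in> S" for x
  proof -
    define t where "t = e / (2 * (norm x + 1))"
    have pos: "norm x + 1 > 0"
      by (intro add_nonneg_pos) auto
    then have t: "t > 0"
      using e(1) by (simp add: t_def)
    have "t * norm x \<le> t * (norm x + 1)" using t by (intro mult_left_mono) auto
    also have "\<dots> = e / 2" using pos by (simp add: t_def field_simps)
    finally have "t * norm x < e" using e(1) by simp
    then have "a + t *\<^sub>R x \<in> S" "a \<in> S"
      using e t by (auto simp: dist_norm subset_iff)
    then have "t *\<^sub>R x \<in> S"
      using assms(1) by (metis add_diff_cancel_left' subspace_diff)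
    then have "(1 / t) *\<^sub>R t *\<^sub>R x \<in> S"
      using assms(1) subspace_scale by blast
    then show ?thesis using t by simp
  qed
  then show ?thesis by blast
qed

lemma nontrivial_kernel_interior_empty:
  fixes f :: "'a::real_normed_vector \<Rightarrow>\<^sub>L 'b::real_normed_vector"
  assumes "f \<noteq> 0"
  shows "interior {x. blinfun_apply f x = 0} = {}"
proof -
  have "subspace {x. blinfun_apply f x = 0}"
    by (auto simp: subspace_def blinfun.add_right blinfun.scaleR_right)
  moreover have "{x. blinfun_apply f x = 0} \<noteq> UNIV"
    using assms blinfun_eqI[of f 0] by auto
  ultimately show ?thesis
    using subspace_with_interior_eq_UNIV by blast
qed

text \<open>The points that fail to separate \<open>g\<close> from \<open>h\<close> form the kernel of \<open>g - h\<close>, which is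
  closed and nowhere dense; countably many of these kernels cannot exhaust a Banach space.\<close>

lemma countable_set_has_separating_point:
  fixes G :: "('a::banach \<Rightarrow>\<^sub>L 'a) set"
  assumes "countable G"
  shows "\<exists>x. separating_point G x"
proof -
  let ?K = "\<lambda>(g, h). {x::'a. blinfun_apply (g - h) x = 0}"
  let ?P = "{p \<in> G \<times> G. fst p \<noteq> snd p}"
  have "euclidean interior_of \<Union>(?K ` ?P) = {}"
  proof (rule Baire_category_alt)
    show "completely_metrizable_space (euclidean :: 'a topology) \<or>
        locally_compact_space (euclidean :: 'a topology) \<and> regular_space (euclidean :: 'a topology)"
      by (simp add: completely_metrizable_space_euclidean)
    show "countable (?K ` ?P)"
      using assms by (intro countable_image countable_subset[OF _ countable_SIGMA[OF assms]]) auto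
    fix T assume "T \<in> ?K ` ?P"
    then obtain g h :: "'a \<Rightarrow>\<^sub>L 'a" where T: "T = {x. blinfun_apply (g - h) x = 0}" "g \<noteq> h"
      by force
    have "closed {x. blinfun_apply (g - h) x = 0}"
      by (intro closed_Collect_eq continuous_intros)
    with T show "closedin euclidean T \<and> euclidean interior_of T = {}"
      using nontrivial_kernel_interior_empty[of "g - h"] by simp
  qed
  then have "\<Union>(?K ` ?P) \<noteq> UNIV"
    by (metis euclidean_interior_of interior_UNIV UNIV_not_empty)
  then obtain x where "x \<notin> \<Union>(?K ` ?P)" by blast
  then have "separating_point G x"
    by (fastforce simp: separating_point_def blinfun.diff_left)
  then show ?thesis ..
qed

section \<open>Compactness of balls in finite-dimensional spaces\<close>

lemma closed_if_compact_in_cballs: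
  fixes S :: "'a::real_normed_vector set"
  assumes "\<And>r. compact (cball 0 r \<inter> S)"
  shows "closed S"
  unfolding closed_sequential_limits
proof (intro allI impI, elim conjE)
  fix x l assume x: "\<forall>n. x n \<in> S" "x \<longlonglongrightarrow> l"
  then obtain r where r: "\<And>n. norm (x n) \<le> r"
    by (meson BseqE convergentI convergent_imp_Bseq)
  have "closed (cball 0 r \<inter> S)"
    using assms compact_imp_closed by blast
  moreover have "x n \<in> cball 0 r \<inter> S" for n
    using x(1) r by auto
  ultimately show "l \<in> S"
    using x(2) closed_sequentially by blast
qed

text \<open>By induction on the spanning set. If \<open>b\<close> lies outside \<open>span B\<close>, which is closed by the induction
  hypothesis, it has positive distance \<open>\<delta>\<close> from it; this bounds the \<open>b\<close>-coordinate of a vector of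
  norm at most \<open>r\<close> by \<open>r / \<delta>\<close>. The vectors in question therefore come from a compact set of
  coordinate pairs in \<open>span B \<times> \<real>\<close>.\<close>

lemma compact_cball_Int_span:
  fixes B :: "'a::real_normed_vector set"
  assumes "finite B"
  shows "compact (cball 0 r \<inter> span B)"
  using assms
proof (induction B arbitrary: r rule: finite_induct)
  case empty
  then show ?case by (cases "r \<ge> 0") auto
next
  case (insert b B)
  show ?case
  proof (cases "b \<in> span B")
    case True
    then show ?thesis using insert.IH by (simp add: span_redundant)
  next
    case False
    have "closed (span B)"
      using insert.IH by (rule closed_if_compact_in_cballs)
    define \<delta> where "\<delta> = infdist b (span B)"
    have \<delta>: "\<delta> > 0"
      unfolding \<delta>_def using False \<open>closed (span B)\<close> span_zero
      by (metis empty_iff in_closed_iff_infdist_zero infdist_nonneg less_eq_real_def)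
    have coord: "\<bar>t\<bar> * \<delta> \<le> norm (y + t *\<^sub>R b)" if "y \<in> span B" for y t
    proof (cases "t = 0")
      case False
      \<comment> \<open>Divide by \<open>t\<close>: the vector \<open>b + y / t\<close> joins a point of \<open>span B\<close> to \<open>b\<close>.\<close>
      have "\<delta> \<le> dist b ((- 1 / t) *\<^sub>R y)"
        unfolding \<delta>_def using that by (intro infdist_le span_scale)
      then have "\<bar>t\<bar> * \<delta> \<le> \<bar>t\<bar> * norm (b + (1 / t) *\<^sub>R y)"
        by (intro mult_left_mono) (auto simp: dist_norm)
      also have "\<dots> = norm (t *\<^sub>R (b + (1 / t) *\<^sub>R y))" by simp
      also have "\<dots> = norm (y + t *\<^sub>R b)"
        using False by (simp add: scaleR_add_right add.commute)
      finally show ?thesis .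
    qed simp
    define s where "s = r / \<delta>"
    let ?f = "\<lambda>(y, t). y + t *\<^sub>R b"
    let ?C = "?f ` ((cball 0 (r + s * norm b) \<inter> span B) \<times> {-s..s})"
    have "compact ?C"
      by (intro compact_continuous_image compact_Times insert.IH compact_Icc)
        (auto simp: case_prod_beta intro!: continuous_intros)
    moreover have "cball 0 r \<inter> span (insert b B) = cball 0 r \<inter> ?C"
    proof (intro equalityI subsetI)
      fix x assume x: "x \<in> cball 0 r \<inter> span (insert b B)"
      then obtain t where y: "x - t *\<^sub>R b \<in> span B"
        by (auto simp: span_insert)
      from coord[OF y, of t] x have "\<bar>t\<bar> * \<delta> \<le> r" by simp
      then have t: "\<bar>t\<bar> \<le> s" using \<delta> by (simp add: s_def field_simps)
      have "norm (x - t *\<^sub>R b) \<le> norm x + \<bar>t\<bar> * norm b"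
        by (metis norm_scaleR norm_triangle_ineq4)
      also have "\<dots> \<le> r + s * norm b"
        using x t by (intro add_mono mult_right_mono) auto
      finally have "(x - t *\<^sub>R b, t) \<in> (cball 0 (r + s * norm b) \<inter> span B) \<times> {-s..s}"
        using y t by auto
      then have "?f (x - t *\<^sub>R b, t) \<in> ?C" by (rule imageI)
      then show "x \<in> cball 0 r \<inter> ?C" using x by simp
    next
      fix x assume x: "x \<in> cball 0 r \<inter> ?C"
      then obtain y t where "y \<in> span B" "x = y + t *\<^sub>R b"
        by auto
      then have "x \<in> span (insert b B)"
        by (simp add: span_add span_base span_scale span_superset[THEN subsetD]
            span_mono[of B "insert b B", THEN subsetD] subset_insertI)
      with x show "x \<in> cball 0 r \<inter> span (insert b B)" by simp
    qed
    ultimately show ?thesis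
      by (simp add: closed_Int_compact)
  qed
qed

section \<open>Groups of isometries of an equivalent norm\<close>

text \<open>Uniform boundedness makes the sequence equicontinuous, so the Cauchy property passes from the
  dense set to every point.\<close>

lemma convergent_on_dense_imp_convergent:
  fixes g :: "nat \<Rightarrow> 'a::real_normed_vector \<Rightarrow>\<^sub>L 'b::banach"
  assumes bound: "\<And>k x. norm (blinfun_apply (g k) x) \<le> K * norm x"
    and dense: "closure D = UNIV"
    and conv: "\<And>d. d \<in> D \<Longrightarrow> convergent (\<lambda>k. blinfun_apply (g k) d)"
  shows "convergent (\<lambda>k. blinfun_apply (g k) x)"
proof -
  have "Cauchy (\<lambda>k. blinfun_apply (g k) x)"
  proof (rule metric_CauchyI)
    fix e :: real assume e: "e > 0"
    define K' where "K' = \<bar>K\<bar> + 1"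
    have K': "K' > 0" by (simp add: K'_def)
    have bd: "norm (blinfun_apply (g k) y) \<le> K' * norm y" for k y
      using bound[of k y] by (rule order_trans) (auto simp: K'_def intro!: mult_right_mono)
    obtain d where d: "d \<in> D" "dist d x < e / (3 * K')"
      using dense e K' closure_approachable[of x D]
      by (metis UNIV_I divide_pos_pos mult_pos_pos zero_less_numeral)
    have near: "dist (blinfun_apply (g k) x) (blinfun_apply (g k) d) < e / 3" for k
    proof -
      have "dist (blinfun_apply (g k) x) (blinfun_apply (g k) d) \<le> K' * dist d x"
        using bd[of k "x - d"] by (simp add: dist_norm blinfun.diff_right norm_minus_commute)
      also have "\<dots> < e / 3" using d(2) K' by (simp add: field_simps)
      finally show ?thesis .
    qed
    have "Cauchy (\<lambda>k. blinfun_apply (g k) d)"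
      using conv[OF d(1)] by (rule convergent_Cauchy)
    then obtain M where M: "\<And>m n. m \<ge> M \<Longrightarrow> n \<ge> M \<Longrightarrow>
        dist (blinfun_apply (g m) d) (blinfun_apply (g n) d) < e / 3"
      using e by (metis metric_CauchyD divide_pos_pos zero_less_numeral)
    have "dist (blinfun_apply (g m) x) (blinfun_apply (g n) x) < e" if "m \<ge> M" "n \<ge> M" for m n
      using near[of m] near[of n] M[OF that]
        dist_triangle[of "blinfun_apply (g m) x" "blinfun_apply (g n) x" "blinfun_apply (g m) d"]
        dist_triangle[of "blinfun_apply (g m) d" "blinfun_apply (g n) x" "blinfun_apply (g n) d"]
      by (simp add: dist_commute)
    then show "\<exists>M. \<forall>m\<ge>M. \<forall>n\<ge>M. dist (blinfun_apply (g m) x) (blinfun_apply (g n) x) < e"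
      by blast
  qed
  then show ?thesis by (simp add: Cauchy_convergent_iff)
qed

locale isometry_group =
  fixes G :: "('a::banach \<Rightarrow>\<^sub>L 'a) set" and N :: "'a \<Rightarrow> real"
  assumes subgroup: "subgroup G isomorphisms"
    and equivalent: "equivalent_norm N"
    and isometries: "blinfun_apply ` G = isometries N"
begin

abbreviation inverse_op :: "('a \<Rightarrow>\<^sub>L 'a) \<Rightarrow> ('a \<Rightarrow>\<^sub>L 'a)"
  where "inverse_op g \<equiv> inv\<^bsub>isomorphisms\<^esub> g"

lemma compose_closed: "g \<in> G \<Longrightarrow> h \<in> G \<Longrightarrow> g o\<^sub>L h \<in> G"
  using subgroup.m_closed[OF subgroup] by (simp add: isomorphisms_def)

lemma inverse_closed: "g \<in> G \<Longrightarrow> inverse_op g \<in> G"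
  by (rule subgroup.m_inv_closed[OF subgroup])

lemma bij_member: "g \<in> G \<Longrightarrow> bij (blinfun_apply g)"
  using subgroup.subset[OF subgroup] by (auto simp: isomorphisms_def)

lemma N_member: "g \<in> G \<Longrightarrow> N (blinfun_apply g x) = N x"
  using isometries by (auto simp: isometries_def)

text \<open>The map \<open>f\<close> is arbitrary because the bound has to apply to the set-theoretic inverse of a member
  of \<open>G\<close> before that inverse is known to be bounded.\<close>

lemma uniformly_bounded:
  obtains K where "\<And>f x. N (f x) = N x \<Longrightarrow> norm (f x) \<le> K * norm x"
proof -
  obtain c C where c: "c > 0" "C > 0" "\<And>x. c * norm x \<le> N x" "\<And>x. N x \<le> C * norm x"
    using equivalent by (auto simp: equivalent_norm_def)
  have "norm (f x) \<le> C / c * norm x" if "N (f x) = N x" for f and x :: 'a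
    using order_trans[OF c(3)[of "f x"], of "C * norm x"] c(4)[of x] that c(1)
    by (simp add: field_simps)
  then show thesis using that by blast
qed

lemma continuous_N: "continuous_on UNIV N"
proof -
  obtain C where C: "C > 0" "\<And>x. N x \<le> C * norm x"
    using equivalent by (auto simp: equivalent_norm_def)
  have tri: "N (x + y) \<le> N x + N y" for x y
    using equivalent by (auto simp: equivalent_norm_def is_norm_def)
  have "N x - N y \<le> C * norm (x - y)" for x y
    using tri[of "x - y" y] C(2)[of "x - y"] by simp
  then have "\<bar>N x - N y\<bar> \<le> C * norm (x - y)" for x y
    by (metis abs_le_iff minus_diff_eq norm_minus_commute)
  then have "C-lipschitz_on UNIV N"
    using C(1) by (intro lipschitz_onI) (auto simp: dist_norm)
  then show ?thesis by (rule lipschitz_on_continuous_on)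
qed

text \<open>The inverse preserves \<open>N\<close> and is therefore bounded, so the group inverse is the inverse
  operator.\<close>

lemma inverse_apply:
  assumes "g \<in> G"
  shows "blinfun_apply (inverse_op g) = inv_into UNIV (blinfun_apply g)"
proof (rule m_inv_isomorphisms[OF bij_member[OF assms]])
  let ?h = "inv_into UNIV (blinfun_apply g)"
  have right: "blinfun_apply g (?h x) = x" for x
    using bij_member[OF assms] by (simp add: bij_is_surj surj_f_inv_f)
  have left: "?h (blinfun_apply g x) = x" for x
    using bij_member[OF assms] by (simp add: bij_is_inj inv_f_f)
  obtain K where K: "\<And>f x. N (f x) = N x \<Longrightarrow> norm (f x) \<le> K * norm x"
    by (rule uniformly_bounded) blast
  have "N (?h x) = N x" for x
    using N_member[OF assms, of "?h x"] by (simp only: right)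
  then have "norm (?h x) \<le> K * norm x" for x
    by (rule K)
  moreover have "?h (x + y) = ?h x + ?h y" for x y
    by (metis left right blinfun.add_right)
  moreover have "?h (r *\<^sub>R x) = r *\<^sub>R ?h x" for r x
    by (metis left right blinfun.scaleR_right)
  ultimately show "bounded_linear ?h"
    by (intro bounded_linear_intro[where K = K]) (auto simp: mult.commute)
qed

lemma apply_inverse [simp]: "g \<in> G \<Longrightarrow> blinfun_apply g (blinfun_apply (inverse_op g) x) = x"
  by (simp add: inverse_apply bij_member bij_is_surj surj_f_inv_f)

lemma inverse_apply_self [simp]: "g \<in> G \<Longrightarrow> blinfun_apply (inverse_op g) (blinfun_apply g x) = x"
  by (simp add: inverse_apply bij_member bij_is_inj inv_f_f)

lemma inverse_compose_apply:
  assumes "g \<in> G" "h \<in> G"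
  shows "blinfun_apply (inverse_op (g o\<^sub>L h)) x
       = blinfun_apply (inverse_op h) (blinfun_apply (inverse_op g) x)"
proof -
  have "blinfun_apply (g o\<^sub>L h) (blinfun_apply (inverse_op h) (blinfun_apply (inverse_op g) x)) = x"
    using assms by simp
  then show ?thesis
    by (metis assms compose_closed inverse_apply_self)
qed

text \<open>The pointwise limit \<open>T\<close> preserves \<open>N\<close> by continuity of \<open>N\<close>, and the pointwise limit \<open>S\<close> of the
  inverses is a right inverse of \<open>T\<close>. So \<open>T\<close> is a surjective isometry, and \<open>G\<close> contains all of
  these.\<close>

lemma limit_on_dense_in_group:
  assumes g: "\<And>k. g k \<in> G" and dense: "closure D = UNIV"
    and conv: "\<And>d. d \<in> D \<Longrightarrow> convergent (\<lambda>k. blinfun_apply (g k) d)"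
      "\<And>d. d \<in> D \<Longrightarrow> convergent (\<lambda>k. blinfun_apply (inverse_op (g k)) d)"
  obtains T where "T \<in> G" "\<And>x. (\<lambda>k. blinfun_apply (g k) x) \<longlonglongrightarrow> blinfun_apply T x"
    "\<And>x. (\<lambda>k. blinfun_apply (inverse_op (g k)) x) \<longlonglongrightarrow> blinfun_apply (inverse_op T) x"
proof -
  obtain K where K: "\<And>f x. N (f x) = N x \<Longrightarrow> norm (f x) \<le> K * norm x"
    by (rule uniformly_bounded) blast
  have bound: "norm (blinfun_apply h x) \<le> K * norm x" if "h \<in> G" for h x
    using that by (intro K N_member)
  define T S where "T x = lim (\<lambda>k. blinfun_apply (g k) x)"
    and "S x = lim (\<lambda>k. blinfun_apply (inverse_op (g k)) x)" for x
  have T: "(\<lambda>k. blinfun_apply (g k) x) \<longlonglongrightarrow> T x" for x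
    using convergent_on_dense_imp_convergent[of g, OF bound[OF g] dense conv(1)]
    by (simp add: T_def convergent_LIMSEQ_iff)
  have S: "(\<lambda>k. blinfun_apply (inverse_op (g k)) x) \<longlonglongrightarrow> S x" for x
    using convergent_on_dense_imp_convergent[of "\<lambda>k. inverse_op (g k)",
        OF bound[OF inverse_closed[OF g]] dense conv(2)]
    by (simp add: S_def convergent_LIMSEQ_iff)
  have "linear T"
  proof (rule linearI)
    fix x y r
    have "(\<lambda>k. blinfun_apply (g k) (x + y)) \<longlonglongrightarrow> T x + T y"
      unfolding blinfun.add_right by (intro tendsto_add T)
    then show "T (x + y) = T x + T y" using T LIMSEQ_unique by blast
    have "(\<lambda>k. blinfun_apply (g k) (r *\<^sub>R x)) \<longlonglongrightarrow> r *\<^sub>R T x"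
      unfolding blinfun.scaleR_right by (intro tendsto_scaleR tendsto_const T)
    then show "T (r *\<^sub>R x) = r *\<^sub>R T x" using T LIMSEQ_unique by blast
  qed
  have NT: "N (T x) = N x" for x
  proof -
    have "(\<lambda>k. N (blinfun_apply (g k) x)) \<longlonglongrightarrow> N (T x)"
      using continuous_on_tendsto_compose[OF continuous_N T] by simp
    then show ?thesis using N_member[OF g] by (simp add: LIMSEQ_const_iff)
  qed
  have TS: "T (S x) = x" for x
  proof -
    \<comment> \<open>The terms equal \<open>g k (S x) - x\<close>, which tends to \<open>T (S x) - x\<close>; the uniform bound on \<open>g k\<close>
      makes them tend to \<open>0\<close>.\<close>
    have "(\<lambda>k. blinfun_apply (g k) (S x - blinfun_apply (inverse_op (g k)) x)) \<longlonglongrightarrow> 0"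
    proof (rule Lim_null_comparison)
      show "\<forall>\<^sub>F k in sequentially. norm (blinfun_apply (g k) (S x - blinfun_apply (inverse_op (g k)) x))
          \<le> K * norm (S x - blinfun_apply (inverse_op (g k)) x)"
        by (intro always_eventually allI bound g)
      have "(\<lambda>k. K * norm (S x - blinfun_apply (inverse_op (g k)) x)) \<longlonglongrightarrow> K * norm (S x - S x)"
        by (intro tendsto_intros S)
      then show "(\<lambda>k. K * norm (S x - blinfun_apply (inverse_op (g k)) x)) \<longlonglongrightarrow> 0" by simp
    qed
    moreover have "(\<lambda>k. blinfun_apply (g k) (S x - blinfun_apply (inverse_op (g k)) x)) \<longlonglongrightarrow> T (S x) - x"
      using g by (simp add: blinfun.diff_right) (intro tendsto_diff T tendsto_const)
    ultimately show ?thesis using LIMSEQ_unique by fastforce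
  qed
  have "surj T"
    using TS by (rule surjI)
  then have "T \<in> isometries N"
    using \<open>linear T\<close> NT by (simp add: isometries_def)
  then obtain t where t: "t \<in> G" "blinfun_apply t = T"
    using isometries by (metis imageE)
  have "blinfun_apply (inverse_op t) x = S x" for x
    by (metis TS t inverse_apply_self)
  with t T S that show thesis by simp
qed

text \<open>The codomain, with its product topology, is completely metrizable because the index set is
  countable. Traces of \<open>T\<close> alone need not form a closed set: a pointwise limit of surjective
  isometries can fail to be surjective.\<close>

definition dense_trace :: "(nat \<Rightarrow> 'a) \<Rightarrow> ('a \<Rightarrow>\<^sub>L 'a) \<Rightarrow> nat \<Rightarrow> 'a \<times> 'a"
  where "dense_trace d g = (\<lambda>n. (blinfun_apply g (d n), blinfun_apply (inverse_op g) (d n)))"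

lemma dense_trace_inject:
  assumes "closure (range d) = UNIV" "dense_trace d g = dense_trace d h"
  shows "g = h"
proof (rule blinfun_eqI)
  fix x
  have "blinfun_apply g (d n) = blinfun_apply h (d n)" for n
    using assms(2) by (metis dense_trace_def fst_conv)
  moreover have "closed {x. blinfun_apply g x = blinfun_apply h x}"
    by (intro closed_Collect_eq continuous_intros)
  ultimately have "closure (range d) \<subseteq> {x. blinfun_apply g x = blinfun_apply h x}"
    by (intro closure_minimal) auto
  then show "blinfun_apply g x = blinfun_apply h x"
    using assms(1) by auto
qed

lemma dense_trace_limit:
  assumes dense: "closure (range d) = UNIV" and g: "\<And>k. g k \<in> G"
    and lim: "(\<lambda>k. dense_trace d (g k)) \<longlonglongrightarrow> l"
  obtains T where "T \<in> G" "l = dense_trace d T"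
    "\<And>x. (\<lambda>k. blinfun_apply (g k) x) \<longlonglongrightarrow> blinfun_apply T x"
    "\<And>x. (\<lambda>k. blinfun_apply (inverse_op (g k)) x) \<longlonglongrightarrow> blinfun_apply (inverse_op T) x"
proof -
  have "(\<lambda>k. dense_trace d (g k) n) \<longlonglongrightarrow> l n" for n
    using continuous_on_tendsto_compose[OF continuous_on_product_coordinates lim] by simp
  then have coord: "(\<lambda>k. blinfun_apply (g k) (d n)) \<longlonglongrightarrow> fst (l n)"
    "(\<lambda>k. blinfun_apply (inverse_op (g k)) (d n)) \<longlonglongrightarrow> snd (l n)" for n
    by (auto simp: dense_trace_def dest!: meta_spec[of _ n] dest: tendsto_fst tendsto_snd)
  obtain T where T: "T \<in> G" "\<And>x. (\<lambda>k. blinfun_apply (g k) x) \<longlonglongrightarrow> blinfun_apply T x"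
    "\<And>x. (\<lambda>k. blinfun_apply (inverse_op (g k)) x) \<longlonglongrightarrow> blinfun_apply (inverse_op T) x"
    using coord by (elim limit_on_dense_in_group[OF g dense, rotated 2]) (auto simp: convergent_def)
  have "l n = dense_trace d T n" for n
    using LIMSEQ_unique[OF coord(1) T(2)] LIMSEQ_unique[OF coord(2) T(3)]
    by (simp add: dense_trace_def prod_eq_iff)
  with T that show thesis by blast
qed

lemma closed_dense_trace:
  assumes "closure (range d) = UNIV"
  shows "closed (dense_trace d ` G)"
  unfolding closed_sequential_limits
proof (intro allI impI, elim conjE)
  fix y l assume y: "\<forall>k. y k \<in> dense_trace d ` G" "y \<longlonglongrightarrow> l"
  then obtain g where g: "\<And>k. g k \<in> G" "y = (\<lambda>k. dense_trace d (g k))"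
    unfolding image_iff Bex_def by metis
  show "l \<in> dense_trace d ` G"
    using dense_trace_limit[OF assms g(1) y(2)[unfolded g(2)]] by (metis imageI)
qed

text \<open>Baire's theorem isolates the trace of some \<open>g \<in> G\<close>. For a prescribed \<open>h\<close>, left translation by
  \<open>k = g o\<^sub>L h\<inverse>\<close> sends \<open>h\<close> to \<open>g\<close>, so the condition that the trace of \<open>k o\<^sub>L t\<close> lies in the
  isolating open set singles out \<open>t = h\<close>. In this form the statement serves both for discreteness
  and for the compactness argument.\<close>

lemma member_isolated_by_trace:
  assumes dense: "closure (range d) = UNIV" and "countable G" "h \<in> G"
  obtains k U where "k \<in> G" "open U" "\<And>t. t \<in> G \<Longrightarrow> dense_trace d (k o\<^sub>L t) \<in> U \<longleftrightarrow> t = h"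
proof -
  have "countable (dense_trace d ` G)" "dense_trace d ` G \<noteq> {}"
    using assms by auto
  then obtain p U where "p \<in> dense_trace d ` G" and U: "open U" "U \<inter> dense_trace d ` G = {p}"
    using countable_closed_has_isolated_point closed_dense_trace[OF dense] by metis
  then obtain g where g: "g \<in> G" "p = dense_trace d g" by blast
  define k where "k = g o\<^sub>L inverse_op h"
  have k: "k \<in> G" using g(1) \<open>h \<in> G\<close> by (simp add: k_def compose_closed inverse_closed)
  have "dense_trace d (k o\<^sub>L t) \<in> U \<longleftrightarrow> t = h" if t: "t \<in> G" for t
  proof -
    have "dense_trace d (k o\<^sub>L t) \<in> U \<longleftrightarrow> dense_trace d (k o\<^sub>L t) = dense_trace d g"
      using U(2) g compose_closed[OF k t] by blast
    also have "\<dots> \<longleftrightarrow> k o\<^sub>L t = g"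
      using dense_trace_inject[OF dense] by blast
    also have "\<dots> \<longleftrightarrow> (\<forall>x. blinfun_apply (inverse_op h) (blinfun_apply t x) = x)"
    proof -
      have "inj (blinfun_apply g)" using bij_member[OF g(1)] by (rule bij_is_inj)
      have "k o\<^sub>L t = g \<longleftrightarrow> (\<forall>x. blinfun_apply (k o\<^sub>L t) x = blinfun_apply g x)"
        by (auto intro: blinfun_eqI)
      also have "\<dots> \<longleftrightarrow> (\<forall>x. blinfun_apply (inverse_op h) (blinfun_apply t x) = x)"
        using \<open>inj (blinfun_apply g)\<close> by (simp add: k_def inj_eq)
      finally show ?thesis .
    qed
    also have "\<dots> \<longleftrightarrow> t = h"
      using \<open>h \<in> G\<close> by (metis apply_inverse inverse_apply_self blinfun_eqI)
    finally show ?thesis .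
  qed
  with k U(1) that show thesis by blast
qed

text \<open>Each coordinate of the translated trace evaluates \<open>t\<close> or its inverse at a fixed vector. This is
  why left translation is continuous in the topology at hand.\<close>

lemma dense_trace_compose:
  assumes "k \<in> G" "t \<in> G"
  shows "dense_trace d (k o\<^sub>L t) = (\<lambda>n. (blinfun_apply k (blinfun_apply t (d n)),
    blinfun_apply (inverse_op t) (blinfun_apply (inverse_op k) (d n))))"
  using assms by (simp add: dense_trace_def inverse_compose_apply)

lemma topspace_SOT_inverse: "topspace (SOT_inverse_topology G) = G"
  by (simp add: SOT_inverse_topology_def topspace_pullback_topology strong_operator_topology_topspace)

lemma continuous_map_SOT_inverse_eval:
  "continuous_map (SOT_inverse_topology G) euclidean (\<lambda>t. blinfun_apply t x)"
  "continuous_map (SOT_inverse_topology G) euclidean (\<lambda>t. blinfun_apply (inverse_op t) x)"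
proof -
  let ?P = "prod_topology strong_operator_topology strong_operator_topology
    :: (('a \<Rightarrow>\<^sub>L 'a) \<times> ('a \<Rightarrow>\<^sub>L 'a)) topology"
  have "continuous_map ?P euclidean ((\<lambda>f. blinfun_apply f x) \<circ> fst)"
    "continuous_map ?P euclidean ((\<lambda>f. blinfun_apply f x) \<circ> snd)"
    by (intro continuous_map_compose[OF _ strong_operator_topology_continuous_evaluation]
        continuous_map_fst continuous_map_snd)+
  from this[THEN continuous_map_pullback, of G "\<lambda>T. (T, inverse_op T)"]
  show "continuous_map (SOT_inverse_topology G) euclidean (\<lambda>t. blinfun_apply t x)"
    "continuous_map (SOT_inverse_topology G) euclidean (\<lambda>t. blinfun_apply (inverse_op t) x)"
    by (simp_all add: SOT_inverse_topology_def comp_def)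
qed

lemma continuous_map_dense_trace_compose:
  assumes "k \<in> G"
  shows "continuous_map (SOT_inverse_topology G) euclidean (\<lambda>t. dense_trace d (k o\<^sub>L t))"
proof (rule continuous_map_eq)
  have k: "continuous_map euclidean euclidean (blinfun_apply k)"
    by (simp add: linear_continuous_on blinfun.bounded_linear_right)
  have "continuous_map (SOT_inverse_topology G) euclidean
      (\<lambda>t. (blinfun_apply k (blinfun_apply t (d n)),
        blinfun_apply (inverse_op t) (blinfun_apply (inverse_op k) (d n))))" for n
    unfolding prod_topology_euclidean[symmetric]
    using continuous_map_compose[OF continuous_map_SOT_inverse_eval(1) k, unfolded comp_def]
    by (intro continuous_map_paired[THEN iffD2] conjI continuous_map_SOT_inverse_eval)
  then show "continuous_map (SOT_inverse_topology G) euclidean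
      (\<lambda>t n. (blinfun_apply k (blinfun_apply t (d n)),
        blinfun_apply (inverse_op t) (blinfun_apply (inverse_op k) (d n))))"
    by (simp add: euclidean_product_topology[symmetric] continuous_map_componentwise_UNIV)
qed (simp add: topspace_SOT_inverse dense_trace_compose assms)

lemma countable_imp_discrete:
  fixes d :: "nat \<Rightarrow> 'a"
  assumes dense: "closure (range d) = UNIV" and "countable G"
  shows "SOT_inverse_topology G = discrete_topology G"
proof -
  have "openin (SOT_inverse_topology G) {h}" if h: "h \<in> G" for h
  proof -
    obtain k U where k: "k \<in> G" "open U"
      and iso: "\<And>t. t \<in> G \<Longrightarrow> dense_trace d (k o\<^sub>L t) \<in> U \<longleftrightarrow> t = h"
      using member_isolated_by_trace[OF assms h] by metis
    have "openin (SOT_inverse_topology G)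
        {t \<in> topspace (SOT_inverse_topology G). dense_trace d (k o\<^sub>L t) \<in> U}"
      using continuous_map_dense_trace_compose[OF k(1)] k(2)
      by (intro openin_continuous_map_preimage) auto
    moreover have "{t \<in> topspace (SOT_inverse_topology G). dense_trace d (k o\<^sub>L t) \<in> U} = {h}"
      using iso h by (auto simp: topspace_SOT_inverse)
    ultimately show ?thesis by simp
  qed
  then show ?thesis
    by (metis discrete_topology_unique topspace_SOT_inverse)
qed

text \<open>Infinitely many traces in a compact set accumulate at some trace, that of \<open>T \<in> G\<close> say. Then
  members of \<open>G\<close> other than \<open>T\<close> converge to \<open>T\<close> pointwise together with their inverses, which
  contradicts the isolation of \<open>T\<close>.\<close>

lemma countable_imp_finite_if_compact_balls:
  fixes d :: "nat \<Rightarrow> 'a"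
  assumes dense: "closure (range d) = UNIV" and "countable G"
    and compact_balls: "\<And>r. compact (cball (0::'a) r)"
  shows "finite G"
proof (rule ccontr)
  assume "infinite G"
  have inj: "inj_on (dense_trace d) G"
    using dense_trace_inject[OF dense] by (auto simp: inj_on_def)
  obtain K where K: "\<And>f x. N (f x) = N x \<Longrightarrow> norm (f x) \<le> K * norm x"
    by (rule uniformly_bounded) blast
  have bound: "norm (blinfun_apply h x) \<le> K * norm x" if "h \<in> G" for h x
    using that by (intro K N_member)
  \<comment> \<open>Tychonoff's theorem: both entries of the \<open>n\<close>-th pair of a trace stay in a compact ball that depends
    only on \<open>n\<close>.\<close>
  let ?C = "\<lambda>n. cball (0::'a) (K * norm (d n)) \<times> cball (0::'a) (K * norm (d n))"
  have "compact (PiE UNIV ?C)"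
    using compactin_PiE[of "\<lambda>_. euclidean" UNIV ?C] compact_balls
    by (simp add: euclidean_product_topology compact_Times)
  moreover have "dense_trace d ` G \<subseteq> PiE UNIV ?C"
    using bound inverse_closed by (auto simp: dense_trace_def)
  moreover have "infinite (dense_trace d ` G)"
    using \<open>infinite G\<close> finite_image_iff[OF inj] by blast
  ultimately obtain l where "l islimpt dense_trace d ` G"
    unfolding compact_eq_Bolzano_Weierstrass by blast
  then obtain y where y: "\<And>k. y k \<in> dense_trace d ` G - {l}" "y \<longlonglongrightarrow> l"
    unfolding islimpt_sequential by blast
  then obtain g where g: "\<And>k. g k \<in> G" "y = (\<lambda>k. dense_trace d (g k))"
    unfolding image_iff Bex_def Diff_iff by metis
  obtain T where T: "T \<in> G" "l = dense_trace d T"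
    "\<And>x. (\<lambda>k. blinfun_apply (g k) x) \<longlonglongrightarrow> blinfun_apply T x"
    "\<And>x. (\<lambda>k. blinfun_apply (inverse_op (g k)) x) \<longlonglongrightarrow> blinfun_apply (inverse_op T) x"
    using dense_trace_limit[OF dense g(1) y(2)[unfolded g(2)]] by metis
  obtain k U where k: "k \<in> G" "open U"
    and iso: "\<And>t. t \<in> G \<Longrightarrow> dense_trace d (k o\<^sub>L t) \<in> U \<longleftrightarrow> t = T"
    using member_isolated_by_trace[OF dense \<open>countable G\<close> T(1)] by metis
  have "limitin euclidean (\<lambda>n. dense_trace d (k o\<^sub>L g n)) (dense_trace d (k o\<^sub>L T)) sequentially"
    unfolding euclidean_product_topology[symmetric] limitin_componentwise
    using k(1) g(1) T(1)
    by (auto simp: dense_trace_compose intro!: tendsto_Pair T(3,4) bounded_linear.tendsto[OF blinfun.bounded_linear_right])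
  then have "\<forall>\<^sub>F n in sequentially. dense_trace d (k o\<^sub>L g n) \<in> U"
    using k(2) iso[OF T(1)] by (auto simp: tendsto_def)
  then have "\<exists>n. g n = T"
    using iso[OF g(1)] by (auto simp: eventually_sequentially)
  then show False
    using y(1) g(2) T(2) by auto
qed

end

theorem lemma9:
  fixes G :: "('a::banach \<Rightarrow>\<^sub>L 'a) set"
  assumes "separable_space (euclidean :: 'a topology)"
    and "subgroup G isomorphisms"
    and "\<exists>N. equivalent_norm N \<and> blinfun_apply ` G = isometries N"
  shows "(countable G \<longrightarrow>
            SOT_inverse_topology G = discrete_topology G \<and> (\<exists>x. separating_point G x)) \<and>
         (finite_dimensional TYPE('a) \<and> countable G \<longrightarrow> finite G)"
proof -
  obtain N where "equivalent_norm N" "blinfun_apply ` G = isometries N"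
    using assms(3) by blast
  then interpret isometry_group G N
    using assms(2) by (intro isometry_group.intro)
  obtain D :: "'a set" where D: "countable D" "closure D = UNIV"
    using assms(1) by (auto simp: separable_space_def)
  then have "D \<noteq> {}" by auto
  with D obtain d :: "nat \<Rightarrow> 'a" where d: "closure (range d) = UNIV"
    by (metis range_from_nat_into)
  have "compact (cball (0::'a) r)" if "finite_dimensional TYPE('a)" for r
    using that compact_cball_Int_span[where 'a = 'a] unfolding finite_dimensional_def
    by (metis Int_UNIV_right)
  then show ?thesis
    using countable_imp_discrete[OF d] countable_set_has_separating_point
      countable_imp_finite_if_compact_balls[OF d] by blast
qed

end
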